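(* Let $\mathcal X$ be an RD-space, let $\rho$ be an admissible function on $\mathcal X$, and let $\mathcal D$ be the collection of balls $B(x,r)$ with $x\in\mathcal X$ and $r\ge\rho(x)$. If $f\in \mathrm{BMO}_\rho(\mathcal X)$, then there exist positive constants $C_3$ and $C_4$ such that for all balls $B$ and all $\lambda>0$, $$\mu(\{x\in B:\ |f(x)-f_B|>\lambda\})\le C_3\,\mu(B)\exp\left\{-\frac{C_4\lambda}{\|f\|_{\mathrm{BMO}_\rho(\mathcal X)}}\right\},$$ and, moreover, for all $B\in\mathcal D$ and all $\lambda>0$, $$\mu(\{x\in B:\ |f(x)|>\lambda\})\le C_3\,\mu(B)\exp\left\{-\frac{C_4\lambda}{\|f\|_{\mathrm{BMO}_\rho(\mathcal X)}}\right\}.$$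
   Context: RD-space: $(\mathcal X,d)$ is a metric space with a regular Borel measure $\mu$ such that all balls $B(x,r)=\{y: d(x,y)<r\}$ have finite and positive measure; $\mu$ is doubling, i.e. there is $A_1\ge1$ with $\mu(B(x,2r))\le A_1\mu(B(x,r))$ for all $x\in\mathcal X$, $r>0$; and there are $0<\kappa\le n$, $A_2\in(0,1]$, $A_3\in[1,\infty)$ such that $A_2\lambda^\kappa\mu(B(x,r))\le\mu(B(x,\lambda r))\le A_3\lambda^n\mu(B(x,r))$ for all $x\in\mathcal X$, $0<r\le \mathrm{diam}(\mathcal X)/2$ and $1\le\lambda\le \mathrm{diam}(\mathcal X)/(2r)$. Balls are understood together with their center and radius. Admissible function: $\rho:\mathcal X\to(0,\infty)$ is admissible if there are positive constants $C_0,k_0$ such that $\frac1{\rho(x)}\le C_0\frac1{\rho(y)}\left(1+\frac{d(x,y)}{\rho(y)}\right)^{k_0}$ for all $x,y\in\mathcal X$. For a locally integrable $f$ (integrable on every ball), $f_B=\frac1{\mu(B)}\int_B f\,d\mu$. A function $f\in L^1_{\rm loc}(\mathcal X)$ is in $\mathrm{BMO}_\rho(\mathcal X)$ if $$\|f\|_{\mathrm{BMO}_\rho(\mathcal X)}=\sup_{B\notin\mathcal D}\frac1{\mu(B)}\int_B|f-f_B|\,d\mu+\sup_{B\in\mathcal D}\frac1{\mu(B)}\int_B|f|\,d\mu<\infty,$$ where $B(x,r)\notin\mathcal D$ means $r<\rho(x)$. If the norm of $f$ is $0$, the exponential is interpreted as $0$. *)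

theory Defs
  imports "HOL-Analysis.Analysis"
begin

(* The approximation from inside is by closed sets, as is usual on metric spaces that need not be
   complete or locally compact.  Compact sets are closed, so approximation by compact sets
   implies it. *)
definition regular_borel_measure :: "'a::metric_space measure \<Rightarrow> bool" where
  "regular_borel_measure M \<longleftrightarrow>
     sets M = sets borel \<and>
     (\<forall>A\<in>sets M.
        emeasure M A = (INF U\<in>{U. open U \<and> A \<subseteq> U}. emeasure M U) \<and>
        emeasure M A = (SUP F\<in>{F. closed F \<and> F \<subseteq> A}. emeasure M F))"

definition doubling_measure :: "'a::metric_space measure \<Rightarrow> bool" where
  "doubling_measure M \<longleftrightarrow>
     (\<exists>A1\<ge>1. \<forall>x r. 0 < r \<longrightarrow> measure M (ball x (2 * r)) \<le> A1 * measure M (ball x r))"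

(* The library's diameter is real-valued and meaningless for unbounded sets. *)
definition space_diam :: "'a::metric_space itself \<Rightarrow> ereal" where
  "space_diam _ = (SUP (x, y)\<in>(UNIV :: ('a \<times> 'a) set). ereal (dist x y))"

definition RD_space :: "'a::metric_space measure \<Rightarrow> bool" where
  "RD_space M \<longleftrightarrow>
     regular_borel_measure M \<and>
     (\<forall>x r. 0 < r \<longrightarrow> 0 < emeasure M (ball x r) \<and> emeasure M (ball x r) < \<infinity>) \<and>
     doubling_measure M \<and>
     (\<exists>\<kappa> n A2 A3 :: real. 0 < \<kappa> \<and> \<kappa> \<le> n \<and> 0 < A2 \<and> A2 \<le> 1 \<and> 1 \<le> A3 \<and>
        (\<forall>x r l. 0 < r \<and> ereal r \<le> space_diam TYPE('a) / 2 \<and>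
             1 \<le> l \<and> ereal l \<le> space_diam TYPE('a) / ereal (2 * r) \<longrightarrow>
           A2 * l powr \<kappa> * measure M (ball x r) \<le> measure M (ball x (l * r)) \<and>
           measure M (ball x (l * r)) \<le> A3 * l powr n * measure M (ball x r)))"

definition admissible :: "('a::metric_space \<Rightarrow> real) \<Rightarrow> bool" where
  "admissible \<rho> \<longleftrightarrow>
     (\<forall>x. 0 < \<rho> x) \<and>
     (\<exists>C0 k0 :: real. 0 < C0 \<and> 0 < k0 \<and>
        (\<forall>x y. 1 / \<rho> x \<le> C0 * (1 / \<rho> y) * (1 + dist x y / \<rho> y) powr k0))"

(* A ball is a pair (x, r) of center and radius: in a metric space the point set ball x r
   need not determine either. *)
definition balls :: "('a::metric_space \<times> real) set" where
  "balls = {(x, r). 0 < r}"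

definition large_balls :: "('a::metric_space \<Rightarrow> real) \<Rightarrow> ('a \<times> real) set" where
  "large_balls \<rho> = {(x, r) \<in> balls. \<rho> x \<le> r}"

definition locally_integrable ::
    "'a::metric_space measure \<Rightarrow> ('a \<Rightarrow> 'b::{banach, second_countable_topology}) \<Rightarrow> bool" where
  "locally_integrable M f \<longleftrightarrow> (\<forall>(x, r)\<in>balls. set_integrable M (ball x r) f)"

definition ball_mean ::
    "'a::metric_space measure \<Rightarrow> ('a \<Rightarrow> 'b::{banach, second_countable_topology}) \<Rightarrow> 'a \<Rightarrow> real \<Rightarrow> 'b" where
  "ball_mean M f x r = (1 / measure M (ball x r)) *\<^sub>R (LINT y:ball x r|M. f y)"

(* Only meaningful for locally integrable f; infinite if one of the suprema is. *)
definition BMO_norm ::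
    "'a::metric_space measure \<Rightarrow> ('a \<Rightarrow> real) \<Rightarrow>
      ('a \<Rightarrow> 'b::{banach, second_countable_topology}) \<Rightarrow> ennreal" where
  "BMO_norm M \<rho> f =
     (SUP (x, r)\<in>balls - large_balls \<rho>.
        ennreal (ball_mean M (\<lambda>y. norm (f y - ball_mean M f x r)) x r)) +
     (SUP (x, r)\<in>large_balls \<rho>. ennreal (ball_mean M (\<lambda>y. norm (f y)) x r))"

definition BMO ::
    "'a::metric_space measure \<Rightarrow> ('a \<Rightarrow> real) \<Rightarrow>
      ('a \<Rightarrow> 'b::{banach, second_countable_topology}) set" where
  "BMO M \<rho> = {f. locally_integrable M f \<and> BMO_norm M \<rho> f < \<infinity>}"

(* The value 0 at N = 0 is a convention; division by zero would give exp 0 = 1. *)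
definition exp_decay :: "real \<Rightarrow> real \<Rightarrow> real \<Rightarrow> real" where
  "exp_decay C l N = (if N = 0 then 0 else exp (- (C * l / N)))"

end

theory Submission
  imports Defs
begin

text \<open>
  The theorem is a John--Nirenberg inequality on a metric space with a doubling measure.  On large
  balls the mean of \<open>norm f\<close> is at most \<open>N\<close>, the norm of \<open>f\<close>, hence the mean oscillation there is
  at most \<open>2 * N\<close>; so the mean oscillation is at most \<open>2 * N\<close> over every ball.  Exponential decay
  of the oscillation (\<open>john_nirenberg\<close>) gives the first estimate, and since the mean over a large
  ball is itself bounded by \<open>N\<close>, replacing \<open>f - f\<^sub>B\<close> by \<open>f\<close> shifts the level by at most \<open>N\<close>, which
  costs only a constant factor.

  Exponential decay follows by iterating one step (\<open>superlevel_halving\<close>): if on every ball the set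
  where the oscillation exceeds \<open>t\<close> fills at most a fraction \<open>\<alpha>\<close> of the ball, then the set where it
  exceeds \<open>t + K\<close> fills at most \<open>\<alpha> / 2\<close>, where \<open>K\<close> is a constant multiple of \<open>N\<close> and \<open>t\<close> is above
  another such multiple.  For the step,
  let \<open>E\<close> be the set where \<open>f\<close> deviates by more than \<open>t\<close> from its mean \<open>m\<close> over the doubled ball.
  Around a point at which the deviation is larger than \<open>t\<close> by a suitable multiple of \<open>N\<close>, shrink a
  ball dyadically until \<open>E\<close> occupies at least a fixed small proportion of it.  The previous ball is mostly
  outside \<open>E\<close>, so the mean of \<open>f\<close> near the point differs from \<open>m\<close> by at most \<open>t\<close> plus a smaller
  multiple of \<open>N\<close>, and by Chebyshev's inequality such large deviations occupy a set that is small
  compared with the part of \<open>E\<close> in the ball (\<open>stopping_radius\<close>).  The local estimates are summed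
  by a Vitali covering (\<open>measure_le_by_local_bounds\<close>).

  At a point where the shrinking never stops, \<open>E\<close> is sparse in all small balls.  One of them lies in
  a given open set \<open>U\<close> containing \<open>E\<close>, and there the same local estimate holds with \<open>U\<close> in place
  of \<open>E\<close>.  So all the local estimates are summed with \<open>U\<close>, and taking the infimum over \<open>U\<close>, outer
  regularity returns the bound by the measure of \<open>E\<close>.
\<close>

section \<open>The Vitali covering lemma in metric spaces\<close>

text \<open>
  Call a disjoint family of the balls good if every ball meeting the family meets a member at least
  half its size.  Such families are closed under unions of chains, and a maximal one meets every
  ball: otherwise a ball of nearly maximal radius among those that are missed could be added.  The
  factor 5 is 1 for the member and 2 * 2 for the diameter of a ball of twice its radius.
\<close>
lemma vitali_five_r_covering:
  fixes r :: "'a::metric_space \<Rightarrow> real"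
  assumes pos: "\<And>x. x \<in> S \<Longrightarrow> 0 < r x" and bdd: "\<And>x. x \<in> S \<Longrightarrow> r x \<le> R"
  obtains G where "G \<subseteq> S" and "disjoint_family_on (\<lambda>x. ball x (r x)) G"
    and "S \<subseteq> (\<Union>x\<in>G. ball x (5 * r x))"
proof -
  define meets where "meets x y \<longleftrightarrow> ball x (r x) \<inter> ball y (r y) \<noteq> {}" for x y
  define good where "good G \<longleftrightarrow> G \<subseteq> S \<and> (\<forall>x\<in>G. \<forall>y\<in>G. x \<noteq> y \<longrightarrow> \<not> meets x y) \<and>
    (\<forall>x\<in>S. (\<exists>y\<in>G. meets x y) \<longrightarrow> (\<exists>y\<in>G. meets x y \<and> r x \<le> 2 * r y))" for G
  have "\<exists>G\<in>Collect good. \<forall>X\<in>Collect good. G \<subseteq> X \<longrightarrow> X = G"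
  proof (rule subset_Zorn_nonempty)
    show "Collect good \<noteq> {}" unfolding good_def by (auto intro!: exI[of _ "{}"])
  next
    fix \<C> assume "\<C> \<noteq> {}" and "subset.chain (Collect good) \<C>"
    then have g: "\<And>G. G \<in> \<C> \<Longrightarrow> good G"
      and ch: "\<And>G H. G \<in> \<C> \<Longrightarrow> H \<in> \<C> \<Longrightarrow> G \<subseteq> H \<or> H \<subseteq> G"
      by (auto simp: subset.chain_def)
    have "\<not> meets x y" if "x \<in> \<Union>\<C>" "y \<in> \<Union>\<C>" "x \<noteq> y" for x y
    proof -
      obtain A B where "A \<in> \<C>" "x \<in> A" "B \<in> \<C>" "y \<in> B" using \<open>x \<in> \<Union>\<C>\<close> \<open>y \<in> \<Union>\<C>\<close> by auto
      then obtain G where "G \<in> \<C>" "x \<in> G" "y \<in> G" using ch[of A B] by auto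
      with g[of G] \<open>x \<noteq> y\<close> show ?thesis by (auto simp: good_def)
    qed
    moreover have "\<Union>\<C> \<subseteq> S" using g unfolding good_def by (meson Union_least)
    moreover have "\<exists>y\<in>\<Union>\<C>. meets x y \<and> r x \<le> 2 * r y" if xy: "x \<in> S" "y \<in> \<Union>\<C>" "meets x y" for x y
    proof -
      obtain G where "G \<in> \<C>" "y \<in> G" using xy by auto
      then show ?thesis using g[of G] xy unfolding good_def by blast
    qed
    ultimately show "\<Union>\<C> \<in> Collect good" unfolding good_def mem_Collect_eq by blast
  qed
  then obtain G where G: "good G" and max: "\<And>X. good X \<Longrightarrow> G \<subseteq> X \<Longrightarrow> X = G" by auto
  have met: "\<exists>y\<in>G. meets x y" if "x \<in> S" for x
  proof (rule ccontr)
    define T where "T = {x\<in>S. \<forall>y\<in>G. \<not> meets x y}"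
    assume "\<not> ?thesis"
    with that have "x \<in> T" by (auto simp: T_def)
    have bT: "bdd_above (r ` T)" using bdd by (auto simp: T_def intro!: bdd_aboveI)
    have "r x \<le> Sup (r ` T)" using bT \<open>x \<in> T\<close> by (simp add: cSup_upper)
    with pos[OF that] have "Sup (r ` T) / 2 < Sup (r ` T)" by simp
    then obtain z where z: "z \<in> T" "Sup (r ` T) / 2 < r z"
      using less_cSUP_iff[OF _ bT, of "Sup (r ` T) / 2"] \<open>x \<in> T\<close> by blast
    have big: "r y \<le> 2 * r z" if "y \<in> T" for y
      using cSup_upper[OF imageI[OF that] bT] z(2) by simp
    have zz: "meets z z" using pos[of z] z(1) by (auto simp: meets_def T_def)
    have sym: "meets a b \<longleftrightarrow> meets b a" for a b by (auto simp: meets_def)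
    have "good (insert z G)"
      unfolding good_def
    proof (intro conjI ballI impI)
      show "insert z G \<subseteq> S" using G z by (auto simp: good_def T_def)
    next
      fix a b assume "a \<in> insert z G" "b \<in> insert z G" "a \<noteq> b"
      then show "\<not> meets a b"
        using G z sym[of a b] unfolding good_def T_def by blast
    next
      fix a assume a: "a \<in> S" "\<exists>y\<in>insert z G. meets a y"
      show "\<exists>y\<in>insert z G. meets a y \<and> r a \<le> 2 * r y"
      proof (cases "a \<in> T")
        case True
        then show ?thesis using a big by (auto simp: T_def)
      next
        case False
        then show ?thesis using a G by (auto simp: T_def good_def)
      qed
    qed
    from max[OF this] have "z \<in> G" by auto
    with z zz show False by (auto simp: T_def)
  qed
  show thesis
  proof (rule that)
    show "G \<subseteq> S" using G by (simp add: good_def)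
    show "disjoint_family_on (\<lambda>x. ball x (r x)) G"
      using G by (auto simp: good_def disjoint_family_on_def meets_def)
    show "S \<subseteq> (\<Union>x\<in>G. ball x (5 * r x))"
    proof
      fix x assume x: "x \<in> S"
      then obtain y where y: "y \<in> G" "meets x y" "r x \<le> 2 * r y"
        using met G by (auto simp: good_def)
      then obtain w where "dist x w < r x" "dist y w < r y" by (auto simp: meets_def)
      then have "dist y x < 5 * r y"
        using y(3) dist_triangle2[of y x w] pos[OF x] by linarith
      then show "x \<in> (\<Union>x\<in>G. ball x (5 * r x))" using y(1) by auto
    qed
  qed
qed

text \<open>
  Finite partial sums of the measures are bounded by the measure of \<open>B\<close>, so only countably many
  terms can be nonzero.  This makes disjoint families of balls countable.
\<close>
lemma countable_disjoint_family_in_finite: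
  assumes disj: "disjoint_family_on A I" and sets: "\<And>i. i \<in> I \<Longrightarrow> A i \<in> sets M"
    and pos: "\<And>i. i \<in> I \<Longrightarrow> 0 < emeasure M (A i)"
    and sub: "\<And>i. i \<in> I \<Longrightarrow> A i \<subseteq> B" and B: "B \<in> sets M" "emeasure M B < \<infinity>"
  shows "countable I"
proof -
  have B': "B \<in> fmeasurable M" using B by (auto intro: fmeasurableI)
  have fin: "A i \<in> fmeasurable M" if "i \<in> I" for i
    using fmeasurableI2[OF B' sub sets] that by auto
  have "(\<Sum>i\<in>F. measure M (A i)) \<le> measure M B" if F: "finite F" "F \<subseteq> I" for F
  proof -
    have "(\<Sum>i\<in>F. measure M (A i)) = measure M (\<Union>i\<in>F. A i)"
      using F disj sets fin
      by (intro measure_finite_Union[symmetric])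
         (auto intro: disjoint_family_on_mono dest!: fmeasurableD2)
    also have "\<dots> \<le> measure M B"
      using F sub sets B' by (intro measure_mono_fmeasurable sets.finite_UN) auto
    finally show ?thesis .
  qed
  then have "(\<lambda>i. measure M (A i)) summable_on I"
    by (intro nonneg_bdd_above_summable_on) (auto intro!: bdd_aboveI)
  then have "countable {i\<in>I. measure M (A i) \<noteq> 0}"
    by (intro abs_summable_countable) simp
  moreover have "measure M (A i) \<noteq> 0" if "i \<in> I" for i
    using pos[OF that] fin[OF that] by (simp add: emeasure_eq_measure2)
  ultimately show ?thesis by (metis (mono_tags, lifting) Collect_cong Collect_mem_eq)
qed

section \<open>Comparing measures of sets by local estimates\<close>

locale doubling_metric_measure =
  fixes M :: "'a::metric_space measure" and D :: real
  assumes sets_M: "sets M = sets borel"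
    and outer_regular:
      "A \<in> sets M \<Longrightarrow> emeasure M A = (INF U\<in>{U. open U \<and> A \<subseteq> U}. emeasure M U)"
    and ball_pos: "0 < r \<Longrightarrow> 0 < emeasure M (ball x r)"
    and ball_finite: "0 < r \<Longrightarrow> emeasure M (ball x r) < \<infinity>"
    and doubling: "0 < r \<Longrightarrow> measure M (ball x (2 * r)) \<le> D * measure M (ball x r)"
begin

lemma space_M [simp]: "space M = UNIV"
  using sets_eq_imp_space_eq[OF sets_M] by simp

lemma open_in_sets: "open U \<Longrightarrow> U \<in> sets M"
  by (simp add: sets_M)

lemma ball_in_sets [measurable, simp]: "ball x r \<in> sets M"
  by (simp add: open_in_sets)

lemma ball_fmeasurable [simp]: "ball x r \<in> fmeasurable M"
proof (cases "0 < r")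
  case True
  then show ?thesis by (intro fmeasurableI ball_finite) auto
next
  case False
  then have "ball x r = {}" by (simp add: ball_empty)
  show ?thesis unfolding \<open>ball x r = {}\<close> by (simp add: fmeasurable_def)
qed

lemma measure_mono_ball:
  "A \<in> sets M \<Longrightarrow> A \<subseteq> B \<Longrightarrow> B \<subseteq> ball x r \<Longrightarrow> B \<in> sets M \<Longrightarrow> measure M A \<le> measure M B"
  by (meson ball_fmeasurable fmeasurableI2 measure_mono_fmeasurable)

lemma measure_ball_pos: "0 < r \<Longrightarrow> 0 < measure M (ball x r)"
  using ball_pos[of r x] by (simp add: emeasure_eq_measure2)

lemma doubling_power:
  assumes "0 < r"
  shows "measure M (ball x (2 ^ k * r)) \<le> D ^ k * measure M (ball x r)"
proof -
  have D: "0 \<le> D"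
    using doubling[OF assms, of x] measure_ball_pos[OF assms, of x]
    by (smt (verit) measure_nonneg mult_less_0_iff)
  show ?thesis
  proof (induction k)
    case (Suc k)
    have "measure M (ball x (2 ^ Suc k * r)) \<le> D * measure M (ball x (2 ^ k * r))"
      using doubling[of "2 ^ k * r" x] assms by (simp add: mult.assoc)
    with mult_left_mono[OF Suc D] show ?case by (simp add: mult.assoc)
  qed simp
qed

lemma doubling_ge_1: "1 \<le> D"
proof -
  have "measure M (ball undefined 1) \<le> measure M (ball undefined 2)"
    by (intro measure_mono_fmeasurable subset_ball) auto
  also have "\<dots> \<le> D * measure M (ball undefined 1)" using doubling[of 1 undefined] by simp
  finally show ?thesis using measure_ball_pos[of 1 undefined] by simp
qed

text \<open>
  The balls of a Vitali subfamily are disjoint, while their fivefold dilates cover \<open>F\<close>.  Hence the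
  left-hand sides of the local bounds dominate \<open>F\<close>, and the right-hand sides add up to at most \<open>U\<close>.
\<close>
lemma emeasure_le_by_covering:
  assumes F: "F \<in> sets M" "F \<subseteq> ball x0 R" and U: "U \<in> sets M"
    and loc: "\<And>x. x \<in> F \<Longrightarrow> \<exists>\<rho>>0. \<rho> \<le> R \<and>
      emeasure M (F \<inter> ball x (5 * \<rho>)) \<le> \<eta> * emeasure M (U \<inter> ball x \<rho>)"
  shows "emeasure M F \<le> \<eta> * emeasure M U"
proof -
  obtain \<rho> where \<rho>: "\<And>x. x \<in> F \<Longrightarrow> 0 < \<rho> x \<and> \<rho> x \<le> R \<and>
      emeasure M (F \<inter> ball x (5 * \<rho> x)) \<le> \<eta> * emeasure M (U \<inter> ball x (\<rho> x))"
    using loc by metis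
  obtain G where G: "G \<subseteq> F" "disjoint_family_on (\<lambda>x. ball x (\<rho> x)) G"
    "F \<subseteq> (\<Union>x\<in>G. ball x (5 * \<rho> x))"
  proof (rule vitali_five_r_covering)
    show "0 < \<rho> x" "\<rho> x \<le> R" if "x \<in> F" for x using \<rho>[OF that] by auto
  qed
  have inball: "ball x (\<rho> x) \<subseteq> ball x0 (2 * R)" if "x \<in> G" for x
  proof
    fix y assume "y \<in> ball x (\<rho> x)"
    moreover have "x \<in> F" "dist x0 x < R" using that G(1) F(2) by auto
    ultimately show "y \<in> ball x0 (2 * R)"
      using \<rho>[of x] dist_triangle[of x0 y x] by auto
  qed
  have "countable G"
  proof (rule countable_disjoint_family_in_finite[OF G(2)])
    show "0 < emeasure M (ball x (\<rho> x))" if "x \<in> G" for x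
      using ball_pos \<rho> G(1) that by auto
    show "emeasure M (ball x0 (2 * R)) < \<infinity>"
      using ball_fmeasurable by (auto simp: fmeasurable_def)
  qed (use inball in auto)
  \<comment> \<open>The family is renumbered by natural numbers, with empty sets at the unused indices.\<close>
  define I where "I = to_nat_on G ` G"
  define V where "V n = (if n \<in> I then U \<inter> ball (from_nat_into G n) (\<rho> (from_nat_into G n)) else {})" for n
  define W where "W n = (if n \<in> I then F \<inter> ball (from_nat_into G n) (5 * \<rho> (from_nat_into G n)) else {})" for n
  have I: "from_nat_into G n \<in> G" "to_nat_on G (from_nat_into G n) = n" if "n \<in> I" for n
    using that \<open>countable G\<close> by (auto simp: I_def)
  have disjV: "disjoint_family V"
    unfolding disjoint_family_on_def
  proof (intro ballI impI)
    fix m n :: nat assume "m \<noteq> n"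
    show "V m \<inter> V n = {}"
    proof (cases "m \<in> I \<and> n \<in> I")
      case True
      then have "from_nat_into G m \<noteq> from_nat_into G n"
        using I \<open>m \<noteq> n\<close> by metis
      then have "ball (from_nat_into G m) (\<rho> (from_nat_into G m)) \<inter>
          ball (from_nat_into G n) (\<rho> (from_nat_into G n)) = {}"
        using disjoint_family_onD[OF G(2)] I True by blast
      then show ?thesis using True by (simp add: V_def) blast
    qed (auto simp: V_def)
  qed
  have VW: "range V \<subseteq> sets M" "range W \<subseteq> sets M" using F U by (auto simp: V_def W_def)
  have "F \<subseteq> (\<Union>n. W n)"
  proof
    fix y assume "y \<in> F"
    then obtain x where "x \<in> G" "y \<in> ball x (5 * \<rho> x)" using G by auto
    then have "y \<in> W (to_nat_on G x)"
      using \<open>y \<in> F\<close> \<open>countable G\<close> by (simp add: W_def I_def)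
    then show "y \<in> (\<Union>n. W n)" by blast
  qed
  then have "emeasure M F \<le> emeasure M (\<Union>n. W n)" using VW by (intro emeasure_mono) auto
  also have "\<dots> \<le> (\<Sum>n. emeasure M (W n))" by (rule emeasure_subadditive_countably[OF VW(2)])
  also have "\<dots> \<le> (\<Sum>n. \<eta> * emeasure M (V n))"
    using I(1) G(1) \<rho> by (intro suminf_le) (auto simp: V_def W_def)
  also have "\<dots> = \<eta> * emeasure M (\<Union>n. V n)"
    using suminf_emeasure[OF VW(1) disjV] by simp
  also have "\<dots> \<le> \<eta> * emeasure M U"
    using U by (intro mult_left_mono emeasure_mono) (auto simp: V_def)
  finally show ?thesis .
qed

text \<open>
  The local bounds are required for every open \<open>U\<close> containing \<open>E\<close>, and their radii may depend
  on \<open>U\<close>.  They are therefore easier to verify than bounds by \<open>E\<close> itself, in particular at points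
  where \<open>E\<close> has density zero; outer regularity nevertheless yields the bound by \<open>E\<close>.
\<close>
lemma measure_le_by_local_bounds:
  assumes F: "F \<in> sets M" "F \<subseteq> ball x0 R" and E: "E \<in> fmeasurable M" and \<eta>: "0 \<le> \<eta>"
    and loc: "\<And>x U. x \<in> F \<Longrightarrow> open U \<Longrightarrow> E \<subseteq> U \<Longrightarrow> \<exists>\<rho>>0. \<rho> \<le> R \<and>
      measure M (F \<inter> ball x (5 * \<rho>)) \<le> \<eta> * measure M (U \<inter> ball x \<rho>)"
  shows "measure M F \<le> \<eta> * measure M E"
proof -
  have fin: "A \<inter> ball x r \<in> fmeasurable M" if "A \<in> sets M" for A x r
    by (rule fmeasurableI2[OF ball_fmeasurable Int_lower2 sets.Int[OF that ball_in_sets]])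
  have *: "emeasure M F \<le> ennreal \<eta> * emeasure M U" if U: "open U" "E \<subseteq> U" for U
  proof (rule emeasure_le_by_covering[OF F open_in_sets[OF U(1)]])
    fix x assume "x \<in> F"
    from loc[OF this U] obtain \<rho> where \<rho>: "0 < \<rho>" "\<rho> \<le> R"
      "measure M (F \<inter> ball x (5 * \<rho>)) \<le> \<eta> * measure M (U \<inter> ball x \<rho>)"
      by blast
    have "emeasure M (F \<inter> ball x (5 * \<rho>)) = ennreal (measure M (F \<inter> ball x (5 * \<rho>)))"
      using fin[OF F(1)] by (rule emeasure_eq_measure2)
    also have "\<dots> \<le> ennreal (\<eta> * measure M (U \<inter> ball x \<rho>))"
      using \<rho>(3) by (rule ennreal_leI)
    also have "\<dots> = ennreal \<eta> * emeasure M (U \<inter> ball x \<rho>)"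
      using fin[OF open_in_sets[OF U(1)]] \<eta> by (simp add: emeasure_eq_measure2 ennreal_mult)
    finally show "\<exists>\<rho>>0. \<rho> \<le> R \<and>
      emeasure M (F \<inter> ball x (5 * \<rho>)) \<le> ennreal \<eta> * emeasure M (U \<inter> ball x \<rho>)"
      using \<rho>(1,2) by blast
  qed
  have "emeasure M F \<le> ennreal \<eta> * emeasure M E"
  proof (cases "\<eta> = 0")
    case True
    then show ?thesis using *[of UNIV] by simp
  next
    case False
    have Es: "E \<in> sets M" using E by auto
    have "emeasure M F / ennreal \<eta> \<le> emeasure M E"
      unfolding outer_regular[OF Es]
      using * \<eta> False by (intro INF_greatest) (auto simp: divide_le_posI_ennreal)
    then have "emeasure M F / ennreal \<eta> * ennreal \<eta> \<le> emeasure M E * ennreal \<eta>"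
      by (rule mult_right_mono) simp
    moreover have "emeasure M F / ennreal \<eta> * ennreal \<eta> = emeasure M F"
      using False \<eta> by (simp add: ennreal_divide_times ennreal_times_divide ennreal_mult_divide_eq ennreal_eq_0_iff)
    ultimately show ?thesis by (simp add: mult.commute)
  qed
  moreover have "F \<in> fmeasurable M" by (rule fmeasurableI2[OF ball_fmeasurable F(2,1)])
  ultimately show ?thesis using E \<eta>
    by (simp add: emeasure_eq_measure2 flip: ennreal_mult)
qed

end

section \<open>Means over balls\<close>

context doubling_metric_measure
begin

context
  fixes f :: "'a \<Rightarrow> 'b::{banach, second_countable_topology}" and x :: 'a and r :: real
  assumes r: "0 < r" and int: "set_integrable M (ball x r) f"
begin

lemma set_integrable_diff_const: "set_integrable M (ball x r) (\<lambda>y. f y - c)"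
proof -
  have "set_integrable M (ball x r) (\<lambda>_. c)"
    using ball_finite[OF r] unfolding set_integrable_def
    by (intro integrable_scaleR_left integrable_real_indicator) auto
  with int show ?thesis by (rule set_integral_diff)
qed

lemma set_integrable_norm_diff: "set_integrable M (ball x r) (\<lambda>y. norm (f y - c))"
  using integrable_norm[OF set_integrable_diff_const[of c, unfolded set_integrable_def]]
  unfolding set_integrable_def by simp

lemma superlevel_in_sets: "{y \<in> ball x r. t < norm (f y - c)} \<in> sets M"
proof -
  have "set_borel_measurable M (ball x r) f"
    using int unfolding set_integrable_def set_borel_measurable_def by auto
  moreover have "{z. t < norm (z - c)} \<in> sets borel"
    by (intro borel_open open_Collect_less continuous_intros)
  ultimately have "f -` {z. t < norm (z - c)} \<inter> ball x r \<in> sets M"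
    by (intro set_borel_measurable_sets) auto
  moreover have "f -` {z. t < norm (z - c)} \<inter> ball x r = {y \<in> ball x r. t < norm (f y - c)}"
    by auto
  ultimately show ?thesis by simp
qed

lemma chebyshev_ball:
  assumes "0 < s"
  shows "s * measure M {y \<in> ball x r. s < norm (f y - c)}
    \<le> ball_mean M (\<lambda>y. norm (f y - c)) x r * measure M (ball x r)"
proof -
  let ?g = "\<lambda>y. indicator (ball x r) y *\<^sub>R norm (f y - c)"
  let ?E = "{y \<in> ball x r. s < norm (f y - c)}"
  have g: "integrable M ?g"
    using set_integrable_norm_diff[of c] unfolding set_integrable_def .
  have E: "?E \<in> fmeasurable M"
    using superlevel_in_sets[of s c] by (rule fmeasurableI2[OF ball_fmeasurable, rotated]) auto
  have "s * measure M ?E = (\<integral>y. indicator ?E y *\<^sub>R s \<partial>M)"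
    using E by (simp add: fmeasurable_def)
  also have "\<dots> \<le> (\<integral>y. ?g y \<partial>M)"
    using E by (intro integral_mono g integrable_scaleR_left integrable_real_indicator)
      (auto simp: fmeasurable_def indicator_def)
  also have "\<dots> = ball_mean M (\<lambda>y. norm (f y - c)) x r * measure M (ball x r)"
    using measure_ball_pos[OF r, of x] by (simp add: ball_mean_def set_lebesgue_integral_def)
  finally show ?thesis .
qed

lemma norm_ball_mean_diff_le:
  "norm (ball_mean M f x r - c) * measure M (ball x r) \<le> (LINT y:ball x r|M. norm (f y - c))"
proof -
  let ?m = "measure M (ball x r)"
  have pos: "0 < ?m" using measure_ball_pos[OF r] .
  have const: "set_integrable M (ball x r) (\<lambda>_. c)" "(LINT y:ball x r|M. c) = ?m *\<^sub>R c"
    using ball_finite[OF r] unfolding set_integrable_def set_lebesgue_integral_def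
    by (auto intro!: integrable_scaleR_left integrable_real_indicator)
  have "?m *\<^sub>R (ball_mean M f x r - c) = (LINT y:ball x r|M. f y - c)"
    using pos set_integral_diff(2)[OF int const(1)] const(2)
    by (simp add: ball_mean_def scaleR_diff_right)
  then have "norm (ball_mean M f x r - c) * ?m = norm (LINT y:ball x r|M. f y - c)"
    using pos by (metis abs_of_pos mult.commute norm_scaleR)
  also have "\<dots> \<le> (LINT y:ball x r|M. norm (f y - c))"
    using integral_norm_bound[of M "\<lambda>y. indicator (ball x r) y *\<^sub>R (f y - c)"]
    by (simp add: set_lebesgue_integral_def)
  finally show ?thesis .
qed

lemma norm_ball_mean_le: "norm (ball_mean M f x r) \<le> ball_mean M (\<lambda>y. norm (f y)) x r"
  using norm_ball_mean_diff_le[of 0] measure_ball_pos[OF r, of x]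
  by (simp add: ball_mean_def pos_le_divide_eq)

text \<open>
  By the triangle inequality, since the mean of \<open>f\<close> is no larger in norm than the mean of the norm.
\<close>
lemma mean_oscillation_le:
  "ball_mean M (\<lambda>y. norm (f y - ball_mean M f x r)) x r \<le> 2 * ball_mean M (\<lambda>y. norm (f y)) x r"
proof -
  let ?c = "ball_mean M f x r" and ?m = "measure M (ball x r)"
  have pos: "0 < ?m" using measure_ball_pos[OF r] .
  have f: "set_integrable M (ball x r) (\<lambda>y. norm (f y))"
    using set_integrable_norm_diff[of 0] by simp
  have c: "set_integrable M (ball x r) (\<lambda>_. norm ?c)" "(LINT y:ball x r|M. norm ?c) = ?m * norm ?c"
    using ball_finite[OF r] unfolding set_integrable_def set_lebesgue_integral_def
    by (auto intro!: integrable_mult_left integrable_real_indicator)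
  have "(LINT y:ball x r|M. norm (f y - ?c)) \<le> (LINT y:ball x r|M. norm (f y) + norm ?c)"
    by (intro set_integral_mono set_integrable_norm_diff set_integral_add(1) f c(1)
        norm_triangle_ineq4)
  also have "\<dots> = (LINT y:ball x r|M. norm (f y)) + ?m * norm ?c"
    using set_integral_add(2)[OF f c(1)] c(2) by simp
  finally have "(LINT y:ball x r|M. norm (f y - ?c)) / ?m
      \<le> ((LINT y:ball x r|M. norm (f y)) + ?m * norm ?c) / ?m"
    using pos by (intro divide_right_mono) auto
  also have "\<dots> = ball_mean M (\<lambda>y. norm (f y)) x r + norm ?c"
    using pos by (simp add: ball_mean_def add_divide_distrib)
  finally show ?thesis using norm_ball_mean_le by (simp add: ball_mean_def)
qed

end

end

section \<open>The John--Nirenberg inequality\<close>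

text \<open>
  The distance between successive levels in the iteration, in units of the oscillation bound.  The
  summands are the cost of passing from the mean over a ball to the mean over its double (\<open>D\<close>), of
  comparing the mean over the last non-dense ball with a value in it (\<open>4\<close>), of passing from that
  ball to one five halves as large (\<open>D\<^sup>2\<close>), and the level at which Chebyshev's inequality makes the
  remaining oscillation rare enough (\<open>4 * D ^ 8\<close>).
\<close>
definition jn_step :: "real \<Rightarrow> real" where
  "jn_step D = D + 4 + D\<^sup>2 + 4 * D ^ 8"

locale bounded_mean_oscillation = doubling_metric_measure M D
  for M :: "'a::metric_space measure" and D :: real +
  fixes f :: "'a \<Rightarrow> 'b::{banach, second_countable_topology}" and N :: real
  assumes integrable_on_ball: "0 < r \<Longrightarrow> set_integrable M (ball x r) f"
    and oscillation: "0 < r \<Longrightarrow> ball_mean M (\<lambda>y. norm (f y - ball_mean M f x r)) x r \<le> N"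
begin

lemma superlevel_oscillation:
  assumes "0 < r" "0 < s"
  shows "s * measure M {y \<in> ball x r. s < norm (f y - ball_mean M f x r)} \<le> N * measure M (ball x r)"
  using chebyshev_ball[OF assms(1) integrable_on_ball[OF assms(1)] assms(2), of x "ball_mean M f x r"]
    mult_right_mono[OF oscillation[OF assms(1)] measure_nonneg, of x M "ball x r"] by linarith

lemma oscillation_bound_nonneg: "0 \<le> N"
proof -
  have "0 \<le> 1 * measure M {y \<in> ball undefined 1. 1 < norm (f y - ball_mean M f undefined 1)}"
    by simp
  also have "\<dots> \<le> N * measure M (ball undefined 1)" by (rule superlevel_oscillation) auto
  finally show ?thesis using measure_ball_pos[of 1 undefined] by (simp add: zero_le_mult_iff)
qed

lemma ball_mean_nested:
  assumes r: "0 < r" and r': "0 < r'" and sub: "ball x r \<subseteq> ball x' r'"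
  shows "norm (ball_mean M f x r - ball_mean M f x' r') * measure M (ball x r) \<le> N * measure M (ball x' r')"
proof -
  let ?g = "\<lambda>y. norm (f y - ball_mean M f x' r')"
  have g: "set_integrable M (ball x' r') ?g"
    using set_integrable_norm_diff[OF r' integrable_on_ball[OF r']] .
  have "norm (ball_mean M f x r - ball_mean M f x' r') * measure M (ball x r) \<le> (LINT y:ball x r|M. ?g y)"
    by (rule norm_ball_mean_diff_le[OF r integrable_on_ball[OF r]])
  also have "\<dots> \<le> (LINT y:ball x' r'|M. ?g y)"
    unfolding set_lebesgue_integral_def
    using set_integrable_subset[OF g ball_in_sets sub] g sub
    by (intro integral_mono) (auto simp: set_integrable_def indicator_def)
  also have "\<dots> = ball_mean M ?g x' r' * measure M (ball x' r')"
    using measure_ball_pos[OF r', of x'] by (simp add: ball_mean_def)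
  also have "\<dots> \<le> N * measure M (ball x' r')"
    using oscillation[OF r'] by (rule mult_right_mono) simp
  finally show ?thesis .
qed

text \<open>
  The power of two only serves to bound the measure of the larger ball by iterated doubling.
\<close>
lemma ball_mean_dilate:
  assumes r: "0 < r" and "1 \<le> l" "l \<le> 2 ^ k"
  shows "norm (ball_mean M f x r - ball_mean M f x (l * r)) \<le> D ^ k * N"
proof -
  have "norm (ball_mean M f x r - ball_mean M f x (l * r)) * measure M (ball x r)
      \<le> N * measure M (ball x (l * r))"
    using assms mult_right_mono[of 1 l r] by (intro ball_mean_nested subset_ball) auto
  also have "\<dots> \<le> N * measure M (ball x (2 ^ k * r))"
    using assms oscillation_bound_nonneg
    by (intro mult_left_mono measure_mono_fmeasurable subset_ball mult_right_mono) auto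
  also have "\<dots> \<le> N * (D ^ k * measure M (ball x r))"
    using doubling_power[OF r] oscillation_bound_nonneg by (rule mult_left_mono)
  finally have "norm (ball_mean M f x r - ball_mean M f x (l * r)) * measure M (ball x r)
      \<le> (D ^ k * N) * measure M (ball x r)" by (simp add: ac_simps)
  then show ?thesis using measure_ball_pos[OF r, of x] by simp
qed


text \<open>
  The radius comes from a Calderon--Zygmund stopping argument over the dyadic radii \<open>R / 2 ^ k\<close>.  A
  ball is dense if \<open>E\<close> occupies at least the proportion \<open>1 / (2 * D ^ 4)\<close> of it; the lower bound on
  \<open>t\<close> ensures that the initial ball is not dense.  At the first dense ball, of radius \<open>\<rho>\<close>, the bound
  comes from Chebyshev's inequality on \<open>ball x (5 * \<rho>)\<close>, whose measure is controlled by \<open>E\<close> in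
  \<open>ball x \<rho>\<close>.  If no ball is dense, it comes from the sparsity of \<open>E\<close> in a ball of radius \<open>8 * \<rho>\<close>,
  with \<open>\<rho>\<close> so small that \<open>ball x \<rho>\<close> lies in \<open>U\<close>.
\<close>
lemma stopping_radius:
  fixes x0 x :: 'a and R t :: real
  defines "m \<equiv> ball_mean M f x0 (2 * R)"
  defines "E \<equiv> {y \<in> ball x0 (2 * R). t < norm (f y - m)}"
  defines "F \<equiv> {y \<in> ball x0 R. t + (4 + D\<^sup>2 + 4 * D ^ 8) * N < norm (f y - m)}"
  assumes N: "0 < N" and R: "0 < R" and t: "4 * D ^ 6 * N \<le> t"
    and x: "x \<in> F" and U: "open U" "E \<subseteq> U"
  shows "\<exists>\<rho>>0. \<rho> \<le> R \<and> measure M (F \<inter> ball x (5 * \<rho>)) \<le> 1 / (2 * D) * measure M (U \<inter> ball x \<rho>)"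
proof -
  have D: "1 \<le> D" by (rule doubling_ge_1)
  define dense where "dense \<rho> \<longleftrightarrow> measure M (ball x \<rho>) \<le> 2 * D ^ 4 * measure M (E \<inter> ball x \<rho>)" for \<rho>
  have E_sets: "E \<in> sets M" unfolding E_def
    using R by (intro superlevel_in_sets integrable_on_ball) auto
  have F_sets: "F \<in> sets M" unfolding F_def
    using R by (intro superlevel_in_sets integrable_on_ball) auto
  have FE: "F \<subseteq> E"
  proof
    fix y assume "y \<in> F"
    moreover have "0 \<le> (4 + D\<^sup>2 + 4 * D ^ 8) * N" using N D by simp
    ultimately show "y \<in> E" using R by (simp add: E_def F_def)
  qed
  have dx: "dist x0 x < R" using x by (simp add: F_def)
  have not_dense_R: "\<not> dense R"
  proof
    assume "dense R"
    have t0: "0 < t" using t N D by (smt (verit) mult_pos_pos zero_less_power)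
    have sub: "ball x0 (2 * R) \<subseteq> ball x (2 ^ 2 * R)"
    proof
      fix y assume "y \<in> ball x0 (2 * R)"
      then show "y \<in> ball x (2 ^ 2 * R)" using dx R dist_triangle3[of x y x0] by auto
    qed
    have EE: "measure M (E \<inter> ball x R) \<le> measure M E"
      unfolding E_def by (rule measure_mono_ball[of _ _ x0 "2 * R"]) (use E_sets E_def in auto)
    have "measure M (ball x0 (2 * R)) \<le> measure M (ball x (2 ^ 2 * R))"
      using sub by (rule measure_mono_fmeasurable) auto
    also have "\<dots> \<le> D\<^sup>2 * measure M (ball x R)" by (rule doubling_power[OF R])
    also have "\<dots> \<le> D\<^sup>2 * (2 * D ^ 4 * measure M (E \<inter> ball x R))"
      using \<open>dense R\<close> unfolding dense_def by (rule mult_left_mono) simp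
    also have "\<dots> \<le> D\<^sup>2 * (2 * D ^ 4 * measure M E)"
      using EE D by (intro mult_left_mono) auto
    finally have big: "measure M (ball x0 (2 * R)) \<le> 2 * D ^ 6 * measure M E"
      by (simp add: eval_nat_numeral)
    have "(4 * D ^ 6 * N) * measure M E \<le> t * measure M E" using t by (rule mult_right_mono) simp
    also have "\<dots> \<le> N * measure M (ball x0 (2 * R))"
      unfolding E_def m_def using R t0 by (intro superlevel_oscillation) auto
    also have "\<dots> \<le> N * (2 * D ^ 6 * measure M E)"
      using big N by (intro mult_left_mono) auto
    finally have "2 * D ^ 6 * N * measure M E \<le> 0" by (simp add: algebra_simps)
    moreover have "0 < 2 * D ^ 6 * N" using N D by simp
    ultimately have "measure M E \<le> 0"
      by (meson mult_pos_pos not_le)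
    with EE have "measure M (E \<inter> ball x R) \<le> 0" by simp
    then have "measure M (E \<inter> ball x R) = 0" by (simp add: order_antisym)
    with \<open>dense R\<close> measure_ball_pos[OF R, of x] show False by (simp add: dense_def)
  qed
  show ?thesis
  proof (cases "\<exists>k. dense (R / 2 ^ k)")
    case True
    define k where "k = (LEAST k. dense (R / 2 ^ k))"
    have k: "dense (R / 2 ^ k)" unfolding k_def using True by (metis (mono_tags, lifting) LeastI)
    with not_dense_R obtain j where j: "k = Suc j" by (cases k) auto
    have nj: "\<not> dense (R / 2 ^ j)" using not_less_Least[of j "\<lambda>k. dense (R / 2 ^ k)"] j k_def by simp
    define \<rho> where "\<rho> = R / 2 ^ k"
    have \<rho>: "0 < \<rho>" "2 * \<rho> = R / 2 ^ j" "dense \<rho>" "\<not> dense (2 * \<rho>)"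
      using R j k nj by (auto simp: \<rho>_def)
    have "R / 2 ^ j \<le> R" using R by (simp add: divide_le_eq mult_left_le)
    then have \<rho>R: "2 * \<rho> \<le> R" using \<rho>(2) by simp
    have in2: "ball x (2 * \<rho>) \<subseteq> ball x0 (2 * R)"
    proof
      fix y assume "y \<in> ball x (2 * \<rho>)"
      then show "y \<in> ball x0 (2 * R)" using dx dist_triangle[of x0 y x] \<rho>R by auto
    qed
    define b where "b = ball_mean M f x (2 * \<rho>)"
    define H where "H = {y \<in> ball x (2 * \<rho>). 4 * N < norm (f y - b)}"
    have H_sets: "H \<in> sets M" unfolding H_def
      using \<rho> by (intro superlevel_in_sets integrable_on_ball) auto
    \<comment> \<open>\<open>E\<close> takes less than half of the ball and \<open>H\<close> at most a quarter, so some point is in neither;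
      at this point \<open>f\<close> is close both to \<open>m\<close> and to the mean \<open>b\<close>.\<close>
    have "\<exists>y\<in>ball x (2 * \<rho>). y \<notin> E \<and> y \<notin> H"
    proof (rule ccontr)
      assume "\<not> ?thesis"
      then have "ball x (2 * \<rho>) = (E \<inter> ball x (2 * \<rho>)) \<union> H" by (auto simp: H_def)
      then have "measure M (ball x (2 * \<rho>)) \<le> measure M (E \<inter> ball x (2 * \<rho>)) + measure M H"
        using E_sets H_sets by (metis ball_in_sets measure_Un_le sets.Int)
      moreover have "measure M H \<le> measure M (ball x (2 * \<rho>)) / 4"
        using superlevel_oscillation[of "2 * \<rho>" "4 * N" x] \<rho> N
        by (simp add: H_def b_def mult.assoc mult.left_commute[of 4])
      moreover have "2 * measure M (E \<inter> ball x (2 * \<rho>)) \<le> 2 * D ^ 4 * measure M (E \<inter> ball x (2 * \<rho>))"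
        using D by (intro mult_right_mono) auto
      ultimately show False using \<rho>(4) unfolding dense_def
        using measure_ball_pos[of "2 * \<rho>" x] \<rho>(1) by argo
    qed
    then obtain y where y: "y \<in> ball x (2 * \<rho>)" "y \<notin> E" "y \<notin> H" by blast
    have y_m: "norm (f y - m) \<le> t" using y in2 by (auto simp: E_def)
    have y_b: "norm (f y - b) \<le> 4 * N" using y by (auto simp: H_def)
    define b5 where "b5 = ball_mean M f x (5 * \<rho>)"
    have b5: "norm (b - b5) \<le> D\<^sup>2 * N"
      using ball_mean_dilate[of "2 * \<rho>" "5 / 2" 2 x] \<rho>(1) by (simp add: b_def b5_def)
    let ?G = "{z \<in> ball x (5 * \<rho>). 4 * D ^ 8 * N < norm (f z - b5)}"
    have G_sets: "?G \<in> sets M" using \<rho> by (intro superlevel_in_sets integrable_on_ball) auto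
    have "F \<inter> ball x (5 * \<rho>) \<subseteq> ?G"
    proof
      fix z assume z: "z \<in> F \<inter> ball x (5 * \<rho>)"
      have "f z - m = (f z - b5) - (b - b5) - (f y - b) + (f y - m)" by simp
      then have "norm (f z - m) \<le> norm (f z - b5) + norm (b - b5) + norm (f y - b) + norm (f y - m)"
        by (smt (verit) norm_triangle_ineq norm_triangle_ineq4)
      moreover have "t + (4 * N + D\<^sup>2 * N + 4 * D ^ 8 * N) < norm (f z - m)"
        using z by (simp add: F_def algebra_simps)
      ultimately show "z \<in> ?G" using b5 y_b y_m z by simp
    qed
    then have "measure M (F \<inter> ball x (5 * \<rho>)) \<le> measure M ?G"
      using F_sets G_sets by (intro measure_mono_ball[of _ _ x "5 * \<rho>"]) auto
    moreover have "(4 * D ^ 8 * N) * measure M ?G \<le> (2 * D ^ 7 * N) * measure M (E \<inter> ball x \<rho>)"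
    proof -
      have "measure M (ball x (5 * \<rho>)) \<le> measure M (ball x (2 ^ 3 * \<rho>))"
        using \<rho>(1) by (intro measure_mono_fmeasurable subset_ball) auto
      also have "\<dots> \<le> D ^ 3 * measure M (ball x \<rho>)" by (rule doubling_power[OF \<rho>(1)])
      also have "\<dots> \<le> D ^ 3 * (2 * D ^ 4 * measure M (E \<inter> ball x \<rho>))"
        using \<rho>(3) D unfolding dense_def by (intro mult_left_mono) auto
      also have "\<dots> = 2 * D ^ 7 * measure M (E \<inter> ball x \<rho>)"
        by (simp add: eval_nat_numeral)
      finally have big: "measure M (ball x (5 * \<rho>)) \<le> 2 * D ^ 7 * measure M (E \<inter> ball x \<rho>)" .
      have "(4 * D ^ 8 * N) * measure M ?G \<le> N * measure M (ball x (5 * \<rho>))"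
        unfolding b5_def using \<rho>(1) N D by (intro superlevel_oscillation) auto
      also have "\<dots> \<le> N * (2 * D ^ 7 * measure M (E \<inter> ball x \<rho>))"
        using big N by (intro mult_left_mono) auto
      finally show ?thesis by (simp add: ac_simps)
    qed
    then have "D ^ 7 * N * (2 * D * measure M ?G) \<le> D ^ 7 * N * measure M (E \<inter> ball x \<rho>)"
      by (simp add: power_Suc[symmetric] ac_simps eval_nat_numeral)
    then have "2 * D * measure M ?G \<le> measure M (E \<inter> ball x \<rho>)"
      using N D by simp
    moreover have "measure M (E \<inter> ball x \<rho>) \<le> measure M (U \<inter> ball x \<rho>)"
      using E_sets U by (intro measure_mono_ball[of _ _ x \<rho>]) (auto simp: open_in_sets)
    ultimately have "2 * D * measure M (F \<inter> ball x (5 * \<rho>)) \<le> measure M (U \<inter> ball x \<rho>)"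
      using D by (smt (verit) mult_left_mono)
    then show ?thesis
      using D \<rho>(1) \<rho>R by (intro exI[of _ \<rho>]) (simp add: field_simps)
  next
    case False
    have "x \<in> U" using x FE U by auto
    then obtain e where e: "0 < e" "ball x e \<subseteq> U" using U(1) open_contains_ball by blast
    obtain k where k: "(1 / 2 :: real) ^ k < e / R"
      using real_arch_pow_inv[of "e / R" "1 / 2"] e R by auto
    \<comment> \<open>The offset 3 makes \<open>8 * \<rho>\<close> a dyadic radius, where density has been excluded, with
      \<open>5 * \<rho>\<close> below it.\<close>
    define \<rho> where "\<rho> = R / 2 ^ (k + 3)"
    have \<rho>: "0 < \<rho>" "2 ^ 3 * \<rho> = R / 2 ^ k" using R by (auto simp: \<rho>_def power_add)
    have "R / 2 ^ k < e" using k R by (simp add: power_one_over field_simps)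
    with \<rho> have "\<rho> < e" by simp
    have "2 ^ 3 * \<rho> \<le> R" unfolding \<rho>(2) using R by (simp add: divide_le_eq mult_left_le)
    have "measure M (F \<inter> ball x (5 * \<rho>)) \<le> measure M (E \<inter> ball x (2 ^ 3 * \<rho>))"
      using F_sets E_sets FE \<rho>(1)
      by (intro measure_mono_ball[of _ _ x "2 ^ 3 * \<rho>"]) auto
    then have "2 * D ^ 4 * measure M (F \<inter> ball x (5 * \<rho>)) \<le> 2 * D ^ 4 * measure M (E \<inter> ball x (2 ^ 3 * \<rho>))"
      using D by (intro mult_left_mono) auto
    also have "\<dots> \<le> measure M (ball x (2 ^ 3 * \<rho>))"
      using False unfolding \<rho>(2) dense_def by (simp add: not_le less_imp_le)
    also have "\<dots> \<le> D ^ 3 * measure M (ball x \<rho>)" by (rule doubling_power[OF \<rho>(1)])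
    also have "ball x \<rho> = U \<inter> ball x \<rho>" using e(2) \<open>\<rho> < e\<close> by auto
    finally have "D ^ 3 * (2 * D * measure M (F \<inter> ball x (5 * \<rho>))) \<le> D ^ 3 * measure M (U \<inter> ball x \<rho>)"
      by (simp add: ac_simps eval_nat_numeral)
    then have "2 * D * measure M (F \<inter> ball x (5 * \<rho>)) \<le> measure M (U \<inter> ball x \<rho>)" using D by simp
    then show ?thesis
      using D \<rho>(1) \<open>2 ^ 3 * \<rho> \<le> R\<close> by (intro exI[of _ \<rho>]) (simp add: field_simps)
  qed
qed

text \<open>
  The set \<open>E\<close> is taken on the doubled ball, because the balls of the stopping argument are centred
  anywhere in the original one and must stay within the domain of \<open>E\<close>.  This costs a factor \<open>D\<close>
  in measure, which the factor \<open>1 / (2 * D)\<close> of the local estimates absorbs.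
\<close>
lemma superlevel_halving:
  assumes N: "0 < N" and R: "0 < R" and t: "4 * D ^ 6 * N \<le> t"
    and bound: "\<And>x r. 0 < r \<Longrightarrow>
      measure M {y \<in> ball x r. t < norm (f y - ball_mean M f x r)} \<le> \<alpha> * measure M (ball x r)"
  shows "measure M {y \<in> ball x0 R. t + jn_step D * N < norm (f y - ball_mean M f x0 R)}
    \<le> \<alpha> / 2 * measure M (ball x0 R)"
proof -
  have D: "1 \<le> D" by (rule doubling_ge_1)
  define m where "m = ball_mean M f x0 (2 * R)"
  define E where "E = {y \<in> ball x0 (2 * R). t < norm (f y - m)}"
  define F where "F = {y \<in> ball x0 R. t + (4 + D\<^sup>2 + 4 * D ^ 8) * N < norm (f y - m)}"
  let ?S = "{y \<in> ball x0 R. t + jn_step D * N < norm (f y - ball_mean M f x0 R)}"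
  have E_sets: "E \<in> sets M" unfolding E_def
    using R by (intro superlevel_in_sets integrable_on_ball) auto
  have F_sets: "F \<in> sets M" unfolding F_def
    using R by (intro superlevel_in_sets integrable_on_ball) auto
  have S_sets: "?S \<in> sets M"
    using R by (intro superlevel_in_sets integrable_on_ball) auto
  have "?S \<subseteq> F"
  proof
    fix y assume y: "y \<in> ?S"
    have "norm (ball_mean M f x0 R - m) \<le> D * N"
      using ball_mean_dilate[OF R, of 2 1 x0] by (simp add: m_def)
    moreover have "norm (f y - ball_mean M f x0 R) \<le> norm (f y - m) + norm (ball_mean M f x0 R - m)"
      using norm_triangle_ineq4[of "f y - m" "ball_mean M f x0 R - m"] by simp
    moreover have "t + (D * N + (4 + D\<^sup>2 + 4 * D ^ 8) * N) < norm (f y - ball_mean M f x0 R)"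
      using y by (simp add: jn_step_def algebra_simps)
    ultimately show "y \<in> F" using y by (simp add: F_def)
  qed
  then have "measure M ?S \<le> measure M F"
    using S_sets F_sets by (intro measure_mono_ball[of _ _ x0 R]) (auto simp: F_def)
  also have "\<dots> \<le> 1 / (2 * D) * measure M E"
  proof (rule measure_le_by_local_bounds)
    show "F \<subseteq> ball x0 R" by (auto simp: F_def)
    show "E \<in> fmeasurable M"
      using E_sets by (rule fmeasurableI2[OF ball_fmeasurable, rotated]) (auto simp: E_def)
    fix x U assume "x \<in> F" "open U" "E \<subseteq> U"
    then show "\<exists>\<rho>>0. \<rho> \<le> R \<and>
        measure M (F \<inter> ball x (5 * \<rho>)) \<le> 1 / (2 * D) * measure M (U \<inter> ball x \<rho>)"
      unfolding E_def F_def m_def by (intro stopping_radius N R t)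
  qed (use F_sets D in auto)
  also have "\<dots> \<le> 1 / (2 * D) * (\<alpha> * measure M (ball x0 (2 * R)))"
    unfolding E_def m_def using R D by (intro mult_left_mono bound) auto
  also have "\<dots> \<le> 1 / (2 * D) * (\<alpha> * (D * measure M (ball x0 R)))"
  proof -
    have "0 \<le> \<alpha> * measure M (ball x0 1)"
      using bound[of 1 x0] measure_nonneg order_trans by (meson zero_less_one)
    then have "0 \<le> \<alpha>" using measure_ball_pos[of 1 x0] by (simp add: zero_le_mult_iff)
    then show ?thesis using D doubling[OF R] by (intro mult_left_mono) auto
  qed
  also have "\<dots> = \<alpha> / 2 * measure M (ball x0 R)" using D by simp
  finally show ?thesis .
qed

text \<open>
  The induction starts at level \<open>jn_step D * N\<close> with the trivial bound; this level already exceeds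
  the threshold \<open>4 * D ^ 6 * N\<close> for halving.
\<close>
lemma superlevel_geometric_decay:
  assumes N: "0 < N" and r: "0 < r"
  shows "measure M {y \<in> ball x r. real (Suc j) * (jn_step D * N) < norm (f y - ball_mean M f x r)}
    \<le> (1 / 2) ^ j * measure M (ball x r)"
  using r
proof (induction j arbitrary: x r)
  case 0
  then show ?case
    by (simp del: mem_ball)
      (intro measure_mono_ball[of _ _ x r] superlevel_in_sets integrable_on_ball, auto)
next
  case (Suc j)
  have D: "1 \<le> D" by (rule doubling_ge_1)
  have "D ^ 6 \<le> D ^ 8" using D by (rule power_increasing[rotated]) simp
  then have "4 * D ^ 6 \<le> jn_step D"
    using D zero_le_power2[of D] unfolding jn_step_def by linarith
  then have "4 * D ^ 6 * N \<le> 1 * (jn_step D * N)" using N by simp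
  also have "\<dots> \<le> real (Suc j) * (jn_step D * N)"
    using N D by (intro mult_right_mono) (auto simp: jn_step_def)
  finally show ?case
    using superlevel_halving[OF N Suc.prems, of "real (Suc j) * (jn_step D * N)" "(1 / 2) ^ j" x] Suc.IH
    by (simp add: algebra_simps)
qed

text \<open>
  Interpolating the geometric decay between levels costs a factor 4: one factor 2 because level
  \<open>(j + 1) * K\<close> carries the exponent \<open>j\<close>, and one for rounding \<open>l / K\<close> down.  For levels up to
  \<open>2 * K\<close>, negative ones included, the right-hand side is at least the measure of the ball.
\<close>
theorem john_nirenberg:
  assumes N: "0 < N" and r: "0 < r"
  shows "measure M {y \<in> ball x r. l < norm (f y - ball_mean M f x r)}
    \<le> 4 * measure M (ball x r) * exp (- (ln 2 / jn_step D * l / N))"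
proof -
  define K where "K = jn_step D * N"
  have K: "0 < K" using doubling_ge_1 N by (simp add: K_def jn_step_def add_pos_nonneg)
  let ?S = "\<lambda>l. {y \<in> ball x r. l < norm (f y - ball_mean M f x r)}"
  have S_sets: "?S l \<in> sets M" for l
    using r by (intro superlevel_in_sets integrable_on_ball) auto
  have pow: "exp (- (ln 2 / jn_step D * l / N)) = 2 powr (- (l / K))"
    by (simp add: powr_def K_def)
  show ?thesis
  proof (cases "l \<le> 2 * K")
    case True
    have "measure M (?S l) \<le> measure M (ball x r)"
      using S_sets by (intro measure_mono_ball[of _ _ x r]) auto
    moreover have "1 \<le> 4 * (2 :: real) powr (- (l / K))"
    proof -
      have "(2 :: real) powr (- 2) \<le> 2 powr (- (l / K))"
        using True K by (intro powr_mono) (auto simp: field_simps)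
      then show ?thesis by (simp add: powr_minus)
    qed
    then have "1 * measure M (ball x r) \<le> (4 * 2 powr (- (l / K))) * measure M (ball x r)"
      by (rule mult_right_mono) simp
    ultimately show ?thesis unfolding pow by (simp add: ac_simps)
  next
    case False
    define j where "j = nat \<lfloor>l / K\<rfloor> - 1"
    have lK: "2 \<le> l / K" using False K by (simp add: field_simps)
    then have "2 \<le> \<lfloor>l / K\<rfloor>" by (simp add: le_floor_iff)
    then have j: "real (Suc j) = of_int \<lfloor>l / K\<rfloor>" by (simp add: j_def)
    have "real (Suc j) \<le> l / K" unfolding j by simp
    then have "real (Suc j) * K \<le> l" using K by (simp add: field_simps)
    then have "?S l \<subseteq> ?S (real (Suc j) * K)" by auto
    then have "measure M (?S l) \<le> measure M (?S (real (Suc j) * K))"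
      using S_sets by (intro measure_mono_ball[of _ _ x r]) auto
    also have "\<dots> \<le> (1 / 2) ^ j * measure M (ball x r)"
      unfolding K_def by (rule superlevel_geometric_decay[OF N r])
    also have "\<dots> \<le> (4 * 2 powr (- (l / K))) * measure M (ball x r)"
    proof (rule mult_right_mono)
      have "(1 / 2 :: real) ^ j = 2 powr (- real j)"
        by (simp add: powr_minus powr_realpow power_one_over inverse_eq_divide)
      also have "\<dots> \<le> 2 powr (2 - l / K)"
      proof (rule powr_mono)
        have "l / K \<le> real (Suc j) + 1" unfolding j by linarith
        then show "- real j \<le> 2 - l / K" by simp
      qed simp
      also have "\<dots> = 2 powr 2 * 2 powr (- (l / K))"
        using powr_add[of 2 2 "- (l / K)"] by simp
      finally show "(1 / 2 :: real) ^ j \<le> 4 * 2 powr (- (l / K))" by simp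
    qed simp
    finally show ?thesis unfolding pow by (simp add: ac_simps)
  qed
qed

lemma superlevel_null:
  assumes "N = 0" "0 < r" "0 < l"
  shows "measure M {y \<in> ball x r. l < norm (f y - ball_mean M f x r)} = 0"
proof -
  have "l * measure M {y \<in> ball x r. l < norm (f y - ball_mean M f x r)} \<le> 0"
    using superlevel_oscillation[OF assms(2,3), of x] assms(1) by simp
  then show ?thesis using \<open>0 < l\<close> by (simp add: mult_le_0_iff order_antisym)
qed

end

section \<open>The space of functions of bounded mean oscillation relative to an admissible function\<close>

lemma BMO_norm_bounds:
  assumes "f \<in> BMO M \<rho>" and "0 < r"
  shows "\<not> \<rho> x \<le> r \<Longrightarrow> ball_mean M (\<lambda>y. norm (f y - ball_mean M f x r)) x r \<le> enn2real (BMO_norm M \<rho> f)"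
    and "\<rho> x \<le> r \<Longrightarrow> ball_mean M (\<lambda>y. norm (f y)) x r \<le> enn2real (BMO_norm M \<rho> f)"
proof -
  have fin: "BMO_norm M \<rho> f < top" using assms by (simp add: BMO_def)
  have le: "v \<le> enn2real (BMO_norm M \<rho> f)" if "ennreal v \<le> BMO_norm M \<rho> f" for v
    using that fin by (cases "BMO_norm M \<rho> f") (auto simp: ennreal_le_iff2)
  let ?small = "SUP (x, r)\<in>balls - large_balls \<rho>.
    ennreal (ball_mean M (\<lambda>y. norm (f y - ball_mean M f x r)) x r)"
  let ?large = "SUP (x, r)\<in>large_balls \<rho>. ennreal (ball_mean M (\<lambda>y. norm (f y)) x r)"
  have norm: "?small \<le> BMO_norm M \<rho> f" "?large \<le> BMO_norm M \<rho> f"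
    unfolding BMO_norm_def by (simp_all add: add_increasing add_increasing2)
  show "ball_mean M (\<lambda>y. norm (f y - ball_mean M f x r)) x r \<le> enn2real (BMO_norm M \<rho> f)"
    if "\<not> \<rho> x \<le> r"
    by (rule le, rule order.trans[OF _ norm(1)], rule SUP_upper2[of "(x, r)"])
      (use that assms(2) in \<open>auto simp: balls_def large_balls_def\<close>)
  show "ball_mean M (\<lambda>y. norm (f y)) x r \<le> enn2real (BMO_norm M \<rho> f)"
    if "\<rho> x \<le> r"
    by (rule le, rule order.trans[OF _ norm(2)], rule SUP_upper2[of "(x, r)"])
      (use that assms(2) in \<open>auto simp: balls_def large_balls_def\<close>)
qed

lemma RD_space_doubling:
  assumes "RD_space M"
  obtains D where "doubling_metric_measure M D"
proof -
  from assms obtain D where "\<And>x r. 0 < r \<Longrightarrow> measure M (ball x (2 * r)) \<le> D * measure M (ball x r)"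
    unfolding RD_space_def doubling_measure_def by blast
  with assms have "doubling_metric_measure M D"
    unfolding RD_space_def regular_borel_measure_def by unfold_locales auto
  then show thesis by (rule that)
qed

theorem theorem3p1:
  fixes M :: "'a::metric_space measure"
    and \<rho> :: "'a \<Rightarrow> real"
    and f :: "'a \<Rightarrow> 'k::{real_normed_field, banach, second_countable_topology}"
  assumes "RD_space M"
    and "admissible \<rho>"
    and "f \<in> BMO M \<rho>"
  shows "\<exists>C3 C4 :: real. 0 < C3 \<and> 0 < C4 \<and>
    (\<forall>(x, r)\<in>balls. \<forall>l>0.
       measure M {y \<in> ball x r. norm (f y - ball_mean M f x r) > l}
         \<le> C3 * measure M (ball x r) * exp_decay C4 l (enn2real (BMO_norm M \<rho> f))) \<and>
    (\<forall>(x, r)\<in>large_balls \<rho>. \<forall>l>0.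
       measure M {y \<in> ball x r. norm (f y) > l}
         \<le> C3 * measure M (ball x r) * exp_decay C4 l (enn2real (BMO_norm M \<rho> f)))"
proof -
  define N where "N = enn2real (BMO_norm M \<rho> f)"
  have N: "0 \<le> N" by (simp add: N_def)
  obtain D where "doubling_metric_measure M D" by (rule RD_space_doubling[OF assms(1)])
  then interpret doubling_metric_measure M D .
  have int: "set_integrable M (ball x r) f" if "0 < r" for x r
    using assms(3) that unfolding BMO_def locally_integrable_def balls_def by auto
  have small: "ball_mean M (\<lambda>y. norm (f y - ball_mean M f x r)) x r \<le> N"
    if "0 < r" "\<not> \<rho> x \<le> r" for x r
    unfolding N_def by (rule BMO_norm_bounds(1)[OF assms(3) that])
  have large: "ball_mean M (\<lambda>y. norm (f y)) x r \<le> N" if "0 < r" "\<rho> x \<le> r" for x r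
    unfolding N_def by (rule BMO_norm_bounds(2)[OF assms(3) that])
  have osc: "ball_mean M (\<lambda>y. norm (f y - ball_mean M f x r)) x r \<le> 2 * N" if "0 < r" for x r
  proof (cases "\<rho> x \<le> r")
    case True
    then show ?thesis using mean_oscillation_le[OF that int[OF that], of x] large[OF that True] by simp
  next
    case False
    then show ?thesis using small[OF that False] N by simp
  qed
  interpret bounded_mean_oscillation M D f "2 * N"
    by unfold_locales (use int osc in auto)
  \<comment> \<open>The additional factor 1/2 compensates for the oscillation bound being \<open>2 * N\<close>.\<close>
  define C4 where "C4 = ln 2 / jn_step D / 2"
  have C4: "0 < C4"
    using doubling_ge_1 by (simp add: C4_def jn_step_def add_pos_nonneg)
  have oscillation_decay: "measure M {y \<in> ball x r. norm (f y - ball_mean M f x r) > l}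
      \<le> 4 * measure M (ball x r) * exp (- (C4 * l / N))" if "0 < N" "0 < r" for x r l
    using john_nirenberg[of r x l] that by (simp add: C4_def mult.assoc)
  have 1: "measure M {y \<in> ball x r. norm (f y - ball_mean M f x r) > l}
      \<le> 4 * exp C4 * measure M (ball x r) * exp_decay C4 l N" if "0 < r" "0 < l" for x r l
  proof (cases "N = 0")
    case True
    then show ?thesis using superlevel_null[of r l x] that by (simp add: exp_decay_def)
  next
    case False
    have "4 * measure M (ball x r) * exp (- (C4 * l / N))
        \<le> exp C4 * (4 * measure M (ball x r) * exp (- (C4 * l / N)))"
      using C4 mult_right_mono[of 1 "exp C4" "4 * measure M (ball x r) * exp (- (C4 * l / N))"]
      by simp
    then show ?thesis
      using oscillation_decay[of r x l] that N False by (simp add: exp_decay_def ac_simps)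
  qed
  have 2: "measure M {y \<in> ball x r. norm (f y) > l}
      \<le> 4 * exp C4 * measure M (ball x r) * exp_decay C4 l N" if "0 < r" "\<rho> x \<le> r" "0 < l" for x r l
  proof -
    have mean: "norm (ball_mean M f x r) \<le> N"
      using norm_ball_mean_le[OF that(1) int[OF that(1)], of x] large[OF that(1,2)] by simp
    show ?thesis
    proof (cases "N = 0")
      case True
      then show ?thesis using superlevel_null[of r l x] that mean by (simp add: exp_decay_def)
    next
      case False
      \<comment> \<open>The level \<open>l - N\<close> may be negative, which \<open>oscillation_decay\<close> permits.\<close>
      have sub: "{y \<in> ball x r. norm (f y) > l} \<subseteq> {y \<in> ball x r. norm (f y - ball_mean M f x r) > l - N}"
      proof
        fix y assume "y \<in> {y \<in> ball x r. norm (f y) > l}"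
        then show "y \<in> {y \<in> ball x r. norm (f y - ball_mean M f x r) > l - N}"
          using mean norm_triangle_ineq2[of "f y" "ball_mean M f x r"] by simp
      qed
      have "measure M {y \<in> ball x r. norm (f y) > l}
          \<le> measure M {y \<in> ball x r. norm (f y - ball_mean M f x r) > l - N}"
        using superlevel_in_sets[OF that(1) int[OF that(1)], of x l 0]
          superlevel_in_sets[OF that(1) int[OF that(1)], of x "l - N" "ball_mean M f x r"]
        by (intro measure_mono_ball[OF _ sub, of x r]) auto
      also have "\<dots> \<le> 4 * measure M (ball x r) * exp (- (C4 * (l - N) / N))"
        using N False that by (intro oscillation_decay) auto
      also have "exp (- (C4 * (l - N) / N)) = exp C4 * exp (- (C4 * l / N))"
        using False by (simp add: field_simps flip: exp_add)
      finally show ?thesis using False by (simp add: exp_decay_def ac_simps)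
    qed
  qed
  show ?thesis
    by (intro exI[of _ "4 * exp C4"] exI[of _ C4])
      (use C4 1 2 in \<open>auto simp: N_def balls_def large_balls_def\<close>)
qed

end
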